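(* Let $\mathcal{A}=\{A_1,\dots,A_n\}$ be disjoint regions of $\partial M$, with multipartite cross section $E_w(\mathcal{A})$. Then $$E_w(\mathcal{A})\le 2\min_i\sum_{j\ne i}\operatorname{area}(b_p(A_j)).$$
   Context: $M$ is a Riemannian manifold with boundary (compact, after a cutoff if necessary). $m(\mathcal{A})$ is the minimal hypersurface in $M$ homologous to $A_1\cup\dots\cup A_n$ (assumed unique), $\mathcal{O}:=m(\mathcal{A})$, and $r(\mathcal{A})$ is the region of $M$ bounded by $A_1\cup\dots\cup A_n$ and $\mathcal{O}$. For a partition of $\mathcal{O}$ into non-overlapping regions $A_1',\dots,A_n'$ (one for each $i$, possibly empty), $m(A_iA_i')$ is the minimal hypersurface in $r(\mathcal{A})$ homologous to $A_i\cup A_i'$, and $$E_w(\mathcal{A}):=\min_{\{A_i'\}\text{ partition of }\mathcal{O}}\ \sum_i\operatorname{area}(m(A_iA_i')).$$ $b_p(A_j)$ is the minimal-area hypersurface in $r(\mathcal{A})$ homologous to $A_j$ relative to $\mathcal{O}$, i.e. minimal among hypersurfaces $\partial r\setminus(A_j\cup\mathcal{O})$ with $r\subset r(\mathcal{A})$ a region containing $A_j$ and meeting every $A_k$, $k\ne j$, in a negligible set (the part of $\partial r$ along $\mathcal{O}$ is not counted). Minima over surfaces and partitions are read as infima if not attained. Standing assumption: $E_w(\mathcal{A})$ also equals the optimal value of its convex relaxation, i.e. the infimum of $\sum_i\int_{r(\mathcal{A})}\sqrt g\,|\nabla\psi_i|$ over real functions $\psi_i$ on $r(\mathcal{A})$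 with $\psi_i|_{A_j}=\delta_{ij}$ and $\sum_i\psi_i|_{\mathcal{O}}=1$. *)

theory Defs
  imports "HOL-Analysis.Analysis"
begin

section \<open>Smooth functions\<close>

text \<open>\<open>Ck k U f\<close> is meant for open \<open>U\<close>: all partial derivatives of \<open>f\<close> up to order \<open>k\<close> exist and
  are continuous on \<open>U\<close>. On other sets, smoothness means local smooth extendability.\<close>

primrec Ck :: "nat \<Rightarrow> (real^'n::finite) set \<Rightarrow> (real^'n \<Rightarrow> real) \<Rightarrow> bool" where
  "Ck 0 U f \<longleftrightarrow> continuous_on U f"
| "Ck (Suc k) U f \<longleftrightarrow> (\<forall>x\<in>U. f differentiable (at x)) \<and>
     (\<forall>i. Ck k U (\<lambda>x. frechet_derivative f (at x) (axis i 1)))"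

definition smooth_on :: "(real^'n::finite) set \<Rightarrow> (real^'n \<Rightarrow> real) \<Rightarrow> bool" where
  "smooth_on S f \<longleftrightarrow> (\<forall>x\<in>S. \<exists>U F. open U \<and> x \<in> U \<and> (\<forall>k. Ck k U F) \<and> (\<forall>y\<in>U \<inter> S. F y = f y))"


section \<open>Riemannian manifolds with boundary\<close>

definition bcoord :: "'n::finite" where
  "bcoord = (SOME i. True)"

definition half_space :: "(real^'n::finite) set" where
  "half_space = {x. 0 \<le> x $ bcoord}"

type_synonym ('a, 'n) chart = "'a set \<times> ('a \<Rightarrow> real^'n)"

text \<open>The dimension of the manifold is \<open>CARD('n)\<close>; \<open>gram c x\<close> is the matrix of the metric tensor in
  the coordinates of the chart \<open>c\<close>, at the coordinate point \<open>x\<close>.\<close>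

record ('a, 'n) rmfd =
  points :: "'a set"
  charts :: "('a, 'n) chart set"
  gram :: "('a, 'n) chart \<Rightarrow> real^'n \<Rightarrow> real^'n^'n"

definition param :: "('a, 'n::finite) chart \<Rightarrow> real^'n \<Rightarrow> 'a" where
  "param c = inv_into (fst c) (snd c)"

definition manifold_with_boundary :: "('a::metric_space, 'n::finite) rmfd \<Rightarrow> bool" where
  "manifold_with_boundary X \<longleftrightarrow>
     (\<Union>c\<in>charts X. fst c) = points X \<and>
     (\<forall>c\<in>charts X.
        openin (top_of_set (points X)) (fst c) \<and>
        openin (top_of_set half_space) (snd c ` fst c) \<and>
        homeomorphism (fst c) (snd c ` fst c) (snd c) (param c)) \<and>
     (\<forall>c\<in>charts X. \<forall>c'\<in>charts X. \<forall>i.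
        smooth_on (snd c ` (fst c \<inter> fst c')) (\<lambda>x. snd c' (param c x) $ i))"

definition mbdry :: "('a, 'n::finite) rmfd \<Rightarrow> 'a set" where
  "mbdry X = {p \<in> points X. \<exists>c\<in>charts X. p \<in> fst c \<and> snd c p $ bcoord = 0}"

definition metric_tensor :: "('a, 'n::finite) rmfd \<Rightarrow> bool" where
  "metric_tensor X \<longleftrightarrow>
     (\<forall>c\<in>charts X.
        (\<forall>x\<in>snd c ` fst c. transpose (gram X c x) = gram X c x \<and>
           (\<forall>v. v \<noteq> 0 \<longrightarrow> 0 < v \<bullet> (gram X c x *v v))) \<and>
        (\<forall>i j. smooth_on (snd c ` fst c) (\<lambda>x. gram X c x $ i $ j))) \<and>
     (\<forall>c\<in>charts X. \<forall>c'\<in>charts X. \<forall>x\<in>snd c ` (fst c \<inter> fst c'). \<forall>D.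
        ((snd c' \<circ> param c) has_derivative D) (at x within snd c ` (fst c \<inter> fst c')) \<longrightarrow>
        (\<forall>u v. u \<bullet> (gram X c x *v v) = D u \<bullet> (gram X c' (snd c' (param c x)) *v D v)))"

text \<open>The quantities below that are computed with \<open>chart_at\<close> do not depend on the chart chosen.\<close>

definition chart_at :: "('a, 'n::finite) rmfd \<Rightarrow> 'a \<Rightarrow> ('a, 'n) chart" where
  "chart_at X p = (SOME c. c \<in> charts X \<and> p \<in> fst c)"

definition C1_curve :: "('a::metric_space, 'n::finite) rmfd \<Rightarrow> (real \<Rightarrow> 'a) \<Rightarrow> bool" where
  "C1_curve X \<gamma> \<longleftrightarrow> continuous_on {0..1} \<gamma> \<and> \<gamma> ` {0..1} \<subseteq> points X \<and>
     (\<forall>c\<in>charts X. \<exists>v. continuous_on {t\<in>{0..1}. \<gamma> t \<in> fst c} v \<and>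
        (\<forall>t\<in>{0..1}. \<gamma> t \<in> fst c \<longrightarrow>
           ((snd c \<circ> \<gamma>) has_vector_derivative v t) (at t within {0..1})))"

definition speed :: "('a, 'n::finite) rmfd \<Rightarrow> (real \<Rightarrow> 'a) \<Rightarrow> real \<Rightarrow> real" where
  "speed X \<gamma> t =
     (let c = chart_at X (\<gamma> t); v = vector_derivative (snd c \<circ> \<gamma>) (at t within {0..1})
      in sqrt (v \<bullet> (gram X c (snd c (\<gamma> t)) *v v)))"

definition curve_length :: "('a, 'n::finite) rmfd \<Rightarrow> (real \<Rightarrow> 'a) \<Rightarrow> ennreal" where
  "curve_length X \<gamma> = (\<integral>\<^sup>+t\<in>{0..1}. ennreal (speed X \<gamma> t) \<partial>lborel)"

definition riem_dist :: "('a::metric_space, 'n::finite) rmfd \<Rightarrow> 'a \<Rightarrow> 'a \<Rightarrow> ennreal" where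
  "riem_dist X p q = (INF \<gamma>\<in>{\<gamma>. C1_curve X \<gamma> \<and> \<gamma> 0 = p \<and> \<gamma> 1 = q}. curve_length X \<gamma>)"

text \<open>The ambient metric \<open>dist\<close> is the Riemannian distance on each connected component of the
  manifold (\<open>riem_dist\<close> is infinite between different components, where \<open>dist\<close> only has to be
  compatible with the topology).\<close>

definition riemannian_manifold_with_boundary :: "('a::metric_space, 'n::finite) rmfd \<Rightarrow> bool" where
  "riemannian_manifold_with_boundary X \<longleftrightarrow> manifold_with_boundary X \<and> metric_tensor X \<and>
     (\<forall>p\<in>points X. \<forall>q\<in>points X. riem_dist X p q < \<infinity> \<longrightarrow> ennreal (dist p q) = riem_dist X p q)"


section \<open>Volume, gradient and area\<close>

text \<open>The volume measure is the unique Borel measure with density \<open>sqrt (det g)\<close> in every chart.\<close>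

definition riem_volume :: "('a::metric_space, 'n::finite) rmfd \<Rightarrow> 'a measure" where
  "riem_volume X = (THE \<mu>. sets \<mu> = sets (restrict_space borel (points X)) \<and>
     (\<forall>c\<in>charts X. \<forall>S\<in>sets \<mu>. S \<subseteq> fst c \<longrightarrow>
        emeasure \<mu> S = (\<integral>\<^sup>+x\<in>snd c ` S. ennreal (sqrt (det (gram X c x))) \<partial>lborel)))"

definition grad_norm :: "('a, 'n::finite) rmfd \<Rightarrow> ('a \<Rightarrow> real) \<Rightarrow> 'a \<Rightarrow> real" where
  "grad_norm X f p =
     (let c = chart_at X p; x = snd c p;
          d = (\<chi> i. frechet_derivative (f \<circ> param c) (at x) (axis i 1))
      in sqrt (d \<bullet> (matrix_inv (gram X c x) *v d)))"

text \<open>Hausdorff (outer) measure, normalised so that in integer dimension it extends the Riemannian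
  volume of submanifolds. Empty covering sets cost nothing, also in dimension 0.\<close>

definition hausdorff_outer :: "nat \<Rightarrow> 'a::metric_space set \<Rightarrow> ennreal" where
  "hausdorff_outer k S =
     (SUP \<delta>\<in>{0::real<..}.
       INF C\<in>{C :: nat \<Rightarrow> 'a set. S \<subseteq> (\<Union>i. C i) \<and> (\<forall>i. bounded (C i) \<and> diameter (C i) \<le> \<delta>)}.
         (\<Sum>i. if C i = {} then 0
              else ennreal (unit_ball_vol (real k) * (diameter (C i) / 2) ^ k)))"

definition area :: "('a::metric_space, 'n::finite) rmfd \<Rightarrow> 'a set \<Rightarrow> ennreal" where
  "area X S = hausdorff_outer (CARD('n) - 1) S"

abbreviation area_null :: "('a::metric_space, 'n::finite) rmfd \<Rightarrow> 'a set \<Rightarrow> bool" where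
  "area_null X S \<equiv> area X S = 0"


section \<open>Regions and homologous hypersurfaces\<close>

text \<open>The boundary of a full-dimensional region includes the part along the boundary of the
  manifold.\<close>

definition bdry :: "('a::metric_space, 'n::finite) rmfd \<Rightarrow> 'a set \<Rightarrow> 'a set" where
  "bdry X r = (top_of_set (points X)) frontier_of r \<union> (r \<inter> mbdry X)"

definition boundary_region :: "('a::metric_space, 'n::finite) rmfd \<Rightarrow> 'a set \<Rightarrow> bool" where
  "boundary_region X A \<longleftrightarrow>
     A \<subseteq> mbdry X \<and> area_null X ((top_of_set (mbdry X)) frontier_of A)"

text \<open>Regions of \<open>D\<close> (which is the whole manifold or itself a region) are regular closed sets. The
  last clause says that they have well-defined boundary values on \<open>bdry X D\<close>: almost every point
  there is interior, relative to \<open>D\<close>, either to \<open>r\<close> or to its complement. Without it, closures of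
  infinite unions of tiny balls accumulating at \<open>B\<close> would count as regions containing \<open>B\<close>.\<close>

definition region_in :: "('a::metric_space, 'n::finite) rmfd \<Rightarrow> 'a set \<Rightarrow> 'a set \<Rightarrow> bool" where
  "region_in X D r \<longleftrightarrow> r \<subseteq> D \<and>
     r = (top_of_set (points X)) closure_of ((top_of_set (points X)) interior_of r) \<and>
     area_null X ((top_of_set D) frontier_of r \<inter> bdry X D)"

text \<open>For \<open>r\<close> a region of \<open>D\<close> containing \<open>B\<close> (up to a set of zero area), \<open>bdry X r - B\<close> is a
  hypersurface in \<open>D\<close> homologous to \<open>B\<close>.\<close>

definition region_containing ::
    "('a::metric_space, 'n::finite) rmfd \<Rightarrow> 'a set \<Rightarrow> 'a set \<Rightarrow> 'a set \<Rightarrow> bool" where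
  "region_containing X D B r \<longleftrightarrow> region_in X D r \<and> area_null X (B - r)"

definition min_area :: "('a::metric_space, 'n::finite) rmfd \<Rightarrow> 'a set \<Rightarrow> 'a set \<Rightarrow> ennreal" where
  "min_area X D B = (INF r\<in>{r. region_containing X D B r}. area X (bdry X r - B))"

text \<open>\<open>bdry X R - B\<close> is the minimal hypersurface homologous to \<open>B\<close> in the manifold, unique up to
  sets of zero area, and \<open>R\<close> is the region bounded by it and \<open>B\<close>.\<close>

definition unique_minimal_region ::
    "('a::metric_space, 'n::finite) rmfd \<Rightarrow> 'a set \<Rightarrow> 'a set \<Rightarrow> bool" where
  "unique_minimal_region X B R \<longleftrightarrow>
     region_containing X (points X) B R \<and>
     (\<forall>R'. region_containing X (points X) B R' \<longrightarrow>
        area X (bdry X R - B) \<le> area X (bdry X R' - B) \<and>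
        (area X (bdry X R' - B) = area X (bdry X R - B) \<longrightarrow>
           area_null X (((bdry X R' - B) - (bdry X R - B)) \<union> ((bdry X R - B) - (bdry X R' - B)))))"


section \<open>Multipartite cross section\<close>

text \<open>In the following, \<open>A 0, \<dots>, A (n - 1)\<close> are the given boundary regions and \<open>R\<close> is
  \<open>r(\<A>)\<close>.\<close>

definition outer_surface ::
    "('a::metric_space, 'n::finite) rmfd \<Rightarrow> nat \<Rightarrow> (nat \<Rightarrow> 'a set) \<Rightarrow> 'a set \<Rightarrow> 'a set" where
  "outer_surface X n A R = bdry X R - (\<Union>i<n. A i)"

definition surface_partition ::
    "('a::metric_space, 'n::finite) rmfd \<Rightarrow> nat \<Rightarrow> 'a set \<Rightarrow> (nat \<Rightarrow> 'a set) \<Rightarrow> bool" where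
  "surface_partition X n S P \<longleftrightarrow>
     (\<forall>i<n. closedin (top_of_set S) (P i)) \<and> (\<Union>i<n. P i) = S \<and>
     (\<forall>i<n. \<forall>j<n. i \<noteq> j \<longrightarrow> area_null X (P i \<inter> P j))"

definition E_w ::
    "('a::metric_space, 'n::finite) rmfd \<Rightarrow> nat \<Rightarrow> (nat \<Rightarrow> 'a set) \<Rightarrow> 'a set \<Rightarrow> ennreal" where
  "E_w X n A R = (INF P\<in>{P. surface_partition X n (outer_surface X n A R) P}.
     \<Sum>i<n. min_area X R (A i \<union> P i))"

definition area_bp ::
    "('a::metric_space, 'n::finite) rmfd \<Rightarrow> nat \<Rightarrow> (nat \<Rightarrow> 'a set) \<Rightarrow> 'a set \<Rightarrow> nat \<Rightarrow> ennreal" where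
  "area_bp X n A R j =
     (INF r\<in>{r. region_containing X R (A j) r \<and> (\<forall>k<n. k \<noteq> j \<longrightarrow> area_null X (r \<inter> A k))}.
        area X (bdry X r - (A j \<union> outer_surface X n A R)))"

text \<open>The competitors in the convex relaxation are continuously differentiable inside \<open>R\<close> and
  extend continuously to almost all points of \<open>bdry X R\<close>. Continuity at every boundary point would
  leave no competitor when two of the \<open>A i\<close> are adjacent.\<close>

definition relaxation_competitor ::
    "('a::metric_space, 'n::finite) rmfd \<Rightarrow> nat \<Rightarrow> (nat \<Rightarrow> 'a set) \<Rightarrow> 'a set \<Rightarrow>
      (nat \<Rightarrow> 'a \<Rightarrow> real) \<Rightarrow> bool" where
  "relaxation_competitor X n A R \<psi> \<longleftrightarrow>
     (\<forall>i<n. \<forall>c\<in>charts X. Ck 1 (snd c ` (fst c \<inter> (R - bdry X R))) (\<psi> i \<circ> param c)) \<and>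
     (\<exists>N. area_null X N \<and>
        (\<forall>i<n. \<forall>p\<in>bdry X R - N. continuous (at p within R) (\<psi> i)) \<and>
        (\<forall>i<n. \<forall>j<n. \<forall>p\<in>(R \<inter> A j) - N. \<psi> i p = (if i = j then 1 else 0)) \<and>
        (\<forall>p\<in>outer_surface X n A R - N. (\<Sum>i<n. \<psi> i p) = 1))"

definition relaxed_value ::
    "('a::metric_space, 'n::finite) rmfd \<Rightarrow> nat \<Rightarrow> (nat \<Rightarrow> 'a set) \<Rightarrow> 'a set \<Rightarrow> ennreal" where
  "relaxed_value X n A R = (INF \<psi>\<in>{\<psi>. relaxation_competitor X n A R \<psi>}.
     \<Sum>i<n. \<integral>\<^sup>+p\<in>(R - bdry X R). ennreal (grad_norm X (\<psi> i) p) \<partial>riem_volume X)"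

end

theory Submission
  imports Defs
begin

text \<open>The bound is proved directly for the cross section, without the convex relaxation. Given
  \<open>i\<close> and competitors \<open>r j\<close> for the areas of \<open>b\<^sub>p(A j)\<close>, \<open>j \<noteq> i\<close>, cut the regions \<open>r j\<close> out of
  \<open>R\<close> one after the other and assign the remainder to \<open>i\<close>. The traces of these pieces on the outer
  surface form a partition of it, so the pieces are competitors for the minimal surfaces in the
  definition of \<open>E\<^sub>w\<close>. A point inside \<open>R\<close> that lies in the boundary of \<open>m\<close> of the regions \<open>r j\<close>
  lies in the boundary of no piece if \<open>m = 0\<close>, and of at most \<open>m + 1 \<le> 2 * m\<close> pieces otherwise.
  Since Hausdorff measure is additive on Borel sets, this counting bound carries over to the total
  areas.\<close>

section \<open>Metric outer measures\<close>

text \<open>Additivity on sets at positive distance is Caratheodory's criterion for Borel sets to be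
  measurable. Separation is expressed by a uniform bound \<open>d\<close>, which holds vacuously for
  empty sets.\<close>

definition metric_outer_measure :: "('a::metric_space set \<Rightarrow> ennreal) \<Rightarrow> bool" where
  "metric_outer_measure \<mu> \<longleftrightarrow> outer_measure_space UNIV \<mu> \<and>
     (\<forall>A B d. 0 < d \<longrightarrow> (\<forall>x\<in>A. \<forall>y\<in>B. d \<le> dist x y) \<longrightarrow> \<mu> A + \<mu> B \<le> \<mu> (A \<union> B))"

lemma outer_measure_space_UNIV_iff:
  "outer_measure_space UNIV \<mu> \<longleftrightarrow> \<mu> {} = 0 \<and> (\<forall>A B. A \<subseteq> B \<longrightarrow> \<mu> A \<le> \<mu> B) \<and>
     (\<forall>C. disjoint_family C \<longrightarrow> \<mu> (\<Union>i. C i) \<le> (\<Sum>i. \<mu> (C i)))"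
  by (auto simp: outer_measure_space_def positive_def increasing_def countably_subadditive_def)

text \<open>The axioms speak of disjoint families only; disjointing a sequence keeps its union and
  shrinks its members.\<close>

lemma outer_measure_UN_le:
  assumes "outer_measure_space UNIV \<mu>"
  shows "\<mu> (\<Union>i. C i) \<le> (\<Sum>i. \<mu> (C i))"
proof -
  have "\<mu> (\<Union>i. C i) = \<mu> (\<Union>i. disjointed C i)"
    by (simp add: UN_disjointed_eq)
  also have "\<dots> \<le> (\<Sum>i. \<mu> (disjointed C i))"
    using assms disjoint_family_disjointed by (auto simp: outer_measure_space_UNIV_iff)
  also have "\<dots> \<le> (\<Sum>i. \<mu> (C i))"
  proof (rule suminf_le)
    show "\<mu> (disjointed C n) \<le> \<mu> (C n)" for n
      using assms disjointed_subset[of C n] unfolding outer_measure_space_UNIV_iff by blast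
  qed auto
  finally show ?thesis .
qed

lemma outer_measure_Un_le:
  assumes "outer_measure_space UNIV \<mu>"
  shows "\<mu> (A \<union> B) \<le> \<mu> A + \<mu> B"
proof -
  have "\<mu> (A \<union> B) = \<mu> (\<Union>i. binaryset A B i)"
    by (simp add: UN_binaryset_eq)
  also have "\<dots> \<le> (\<Sum>i. \<mu> (binaryset A B i))"
    by (rule outer_measure_UN_le[OF assms])
  also have "\<dots> = \<mu> A + \<mu> B"
    using assms by (intro suminf_binaryset_eq) (auto simp: outer_measure_space_UNIV_iff)
  finally show ?thesis .
qed

lemma sum_lessThan_double:
  fixes b :: "nat \<Rightarrow> 'b::comm_monoid_add"
  shows "(\<Sum>l<2 * N. b l) = (\<Sum>l<N. b (2 * l)) + (\<Sum>l<N. b (Suc (2 * l)))"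
  by (induction N) (auto simp: ac_simps)

text \<open>The shells \<open>B m\<close> around \<open>C\<close> with indices of equal parity are at positive mutual distance, so
  the sum of their measures is at most \<open>2 * \<mu> E\<close>, and its tails vanish.\<close>

lemma closed_caratheodory_measurable:
  fixes \<mu> :: "'a::metric_space set \<Rightarrow> ennreal"
  assumes \<mu>: "metric_outer_measure \<mu>" and C: "closed C"
  shows "\<mu> (E \<inter> C) + \<mu> (E - C) \<le> \<mu> E"
\<comment> \<open>The distance \<open>infdist\<close> to the empty set is 0 by convention, so that
  case is separate; finiteness of \<open>\<mu> E\<close> permits the final cancellation.\<close>
proof (cases "C = {} \<or> \<mu> E = \<infinity>")
  case True
  then show ?thesis
    using \<mu> by (auto simp: metric_outer_measure_def outer_measure_space_UNIV_iff)
next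
  case False
  then have C_ne: "C \<noteq> {}" and fin: "\<mu> E < \<infinity>"
    by (auto simp: less_top)
  have out: "outer_measure_space UNIV \<mu>"
    using \<mu> by (simp add: metric_outer_measure_def)
  have mono: "\<mu> P \<le> \<mu> Q" if "P \<subseteq> Q" for P Q
    using out that by (auto simp: outer_measure_space_UNIV_iff)
  have sep: "\<mu> P + \<mu> Q \<le> \<mu> (P \<union> Q)" if "0 < d" "\<And>x y. x \<in> P \<Longrightarrow> y \<in> Q \<Longrightarrow> d \<le> dist x y" for P Q d
    using \<mu> that unfolding metric_outer_measure_def by blast
  define D where "D m = {x \<in> E. 1 / real (Suc m) \<le> infdist x C}" for m
  define B where "B m = D (Suc m) - D m" for m
  have inv_mono: "1 / real (Suc l) \<le> 1 / real (Suc m)" if "m \<le> l" for m l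
    using that by (intro divide_left_mono) auto
  have D_mono: "D m \<subseteq> D l" if "m \<le> l" for m l
    using inv_mono[OF that] by (force simp: D_def)
  \<comment> \<open>The shell \<open>B m\<close> lies between \<open>D m\<close> and
    \<open>B (Suc m)\<close> and keeps them apart.\<close>
  have DB: "\<mu> (D m) + \<mu> (B (Suc m)) \<le> \<mu> (D (Suc (Suc m)))" for m
  proof -
    have "\<mu> (D m) + \<mu> (B (Suc m)) \<le> \<mu> (D m \<union> B (Suc m))"
    proof (rule sep)
      show "0 < 1 / real (Suc m) - 1 / real (Suc (Suc m))"
        by (simp add: divide_strict_left_mono)
    next
      fix x y assume "x \<in> D m" "y \<in> B (Suc m)"
      then have "1 / real (Suc m) \<le> infdist x C" "infdist y C < 1 / real (Suc (Suc m))"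
        by (auto simp: B_def D_def not_le)
      then show "1 / real (Suc m) - 1 / real (Suc (Suc m)) \<le> dist x y"
        using infdist_triangle[of x C y] by linarith
    qed
    also have "\<dots> \<le> \<mu> (D (Suc (Suc m)))"
      using D_mono[of m "Suc (Suc m)"] by (intro mono) (auto simp: B_def)
    finally show ?thesis .
  qed
  \<comment> \<open>With \<open>s\<close> equal to 0 or 1 these are the shells of one parity; each
    induction step adds a shell separated from the set \<open>D\<close> that contains all earlier
    ones.\<close>
  have parity: "(\<Sum>l<Suc N. \<mu> (B (2 * l + s))) \<le> \<mu> (D (2 * N + s + 1))" for N s
  proof (induction N)
    case 0
    then show ?case by (auto simp: B_def intro: mono)
  next
    case (Suc N)
    have "(\<Sum>l<Suc (Suc N). \<mu> (B (2 * l + s))) \<le> \<mu> (D (2 * N + s + 1)) + \<mu> (B (Suc (2 * N + s + 1)))"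
      using Suc by (auto intro!: add_mono)
    also have "\<dots> \<le> \<mu> (D (2 * Suc N + s + 1))"
      using DB[of "2 * N + s + 1"] by (simp add: add.commute)
    finally show ?case .
  qed
  have parity_E: "(\<Sum>l<N. \<mu> (B (2 * l + s))) \<le> \<mu> E" for N s
  proof (cases N)
    case (Suc k)
    have "D (2 * k + s + 1) \<subseteq> E" by (auto simp: D_def)
    then show ?thesis using parity[where N=k and s=s] mono Suc order_trans by blast
  qed auto
  have "(\<Sum>l. \<mu> (B l)) \<le> \<mu> E + \<mu> E"
  proof (rule suminf_le_const)
    fix N
    have "(\<Sum>l<N. \<mu> (B l)) \<le> (\<Sum>l<2 * N. \<mu> (B l))"
      by (intro sum_mono2) auto
    also have "\<dots> \<le> \<mu> E + \<mu> E"
      using parity_E[of 0 N] parity_E[of 1 N] by (simp add: sum_lessThan_double add_mono)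
    finally show "(\<Sum>l<N. \<mu> (B l)) \<le> \<mu> E + \<mu> E" .
  qed auto
  then have B_fin: "(\<Sum>l. \<mu> (B l)) \<noteq> \<infinity>"
    using fin by (auto simp: top_unique)
  have cover: "E - C \<subseteq> D m \<union> (\<Union>l. B (l + m))" for m
  proof
    fix x assume x: "x \<in> E - C"
    then have "0 < infdist x C"
      using C C_ne by (metis DiffD2 in_closed_iff_infdist_zero infdist_nonneg less_le)
    then obtain k where "1 / real (Suc k) < infdist x C"
      using nat_approx_posE by blast
    then have "x \<in> D k" using x by (auto simp: D_def)
    show "x \<in> D m \<union> (\<Union>l. B (l + m))"
    proof (cases "x \<in> D m")
      case False
      \<comment> \<open>\<open>x\<close> first enters the increasing sets at an index
        \<open>q > m\<close>, hence lies in the shell \<open>B (q - 1)\<close>.\<close>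
      define q where "q = (LEAST k. x \<in> D k)"
      have q: "x \<in> D q" "\<And>k. k < q \<Longrightarrow> x \<notin> D k"
        using \<open>x \<in> D k\<close> unfolding q_def by (auto intro: LeastI dest: not_less_Least)
      then have "m < q" using False D_mono[of q m] by (meson not_le subsetD)
      then obtain l where "q = Suc (l + m)"
        by (metis add.commute less_iff_Suc_add)
      then have "x \<in> B (l + m)" using q by (simp add: B_def)
      then show ?thesis by blast
    qed simp
  qed
  \<comment> \<open>Adding the first \<open>m\<close> shells completes the tail to the whole series,
    which avoids subtraction in \<open>ennreal\<close>; then \<open>m\<close> tends to infinity and
    the finite series cancels.\<close>
  have "(\<mu> (E \<inter> C) + \<mu> (E - C)) + (\<Sum>l<m. \<mu> (B l)) \<le> \<mu> E + (\<Sum>l. \<mu> (B l))" for m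
  proof -
    have "\<mu> (E - C) \<le> \<mu> (D m \<union> (\<Union>l. B (l + m)))"
      by (intro mono cover)
    also have "\<dots> \<le> \<mu> (D m) + \<mu> (\<Union>l. B (l + m))"
      by (rule outer_measure_Un_le[OF out])
    also have "\<dots> \<le> \<mu> (D m) + (\<Sum>l. \<mu> (B (l + m)))"
      by (intro add_left_mono outer_measure_UN_le[OF out])
    finally have 1: "\<mu> (E - C) \<le> \<mu> (D m) + (\<Sum>l. \<mu> (B (l + m)))" .
    have "\<mu> (E \<inter> C) + \<mu> (D m) \<le> \<mu> (E \<inter> C \<union> D m)"
    proof (rule sep)
      fix x y assume "x \<in> E \<inter> C" "y \<in> D m"
      then show "1 / real (Suc m) \<le> dist x y"
        using infdist_le[of x C y] by (auto simp: D_def dist_commute)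
    qed simp
    also have "\<dots> \<le> \<mu> E" by (rule mono) (auto simp: D_def)
    finally have 2: "\<mu> (E \<inter> C) + \<mu> (D m) \<le> \<mu> E" .
    have 3: "(\<Sum>l. \<mu> (B l)) = (\<Sum>l. \<mu> (B (l + m))) + (\<Sum>l<m. \<mu> (B l))"
      by (rule suminf_offset) auto
    have "(\<mu> (E \<inter> C) + \<mu> (E - C)) + (\<Sum>l<m. \<mu> (B l))
        \<le> (\<mu> (E \<inter> C) + (\<mu> (D m) + (\<Sum>l. \<mu> (B (l + m))))) + (\<Sum>l<m. \<mu> (B l))"
      using 1 by (intro add_mono) auto
    also have "\<dots> = (\<mu> (E \<inter> C) + \<mu> (D m)) + (\<Sum>l. \<mu> (B l))"
      by (simp add: 3 ac_simps)
    also have "\<dots> \<le> \<mu> E + (\<Sum>l. \<mu> (B l))"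
      using 2 by (intro add_mono) auto
    finally show ?thesis .
  qed
  then have "(SUP m. (\<mu> (E \<inter> C) + \<mu> (E - C)) + (\<Sum>l<m. \<mu> (B l))) \<le> \<mu> E + (\<Sum>l. \<mu> (B l))"
    by (intro SUP_least)
  then have "(\<mu> (E \<inter> C) + \<mu> (E - C)) + (\<Sum>l. \<mu> (B l)) \<le> \<mu> E + (\<Sum>l. \<mu> (B l))"
    by (simp add: ennreal_SUP_add_right suminf_eq_SUP)
  then show ?thesis
    using B_fin by (simp add: add.commute[of _ "\<Sum>l. \<mu> (B l)"] ennreal_add_left_cancel_le)
qed

lemma sum_indicator_eq_card_Collect:
  "finite I \<Longrightarrow> (\<Sum>k\<in>I. indicator (H k) x) = (of_nat (card {k \<in> I. x \<in> H k}) :: 'b::semiring_1)"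
  by (simp add: indicator_def sum.If_cases Int_def)

text \<open>The map sending \<open>B\<close> to \<open>\<mu> (S \<inter> B)\<close> is again an
  outer measure and becomes a measure on its Caratheodory sets, which include the Borel sets. Both
  sums are then integrals of counting functions, which compare pointwise.\<close>

lemma sum_outer_measure_le_of_card_le:
  fixes \<mu> :: "'a::metric_space set \<Rightarrow> ennreal"
  assumes \<mu>: "metric_outer_measure \<mu>"
    and fin: "finite K" "finite J"
    and F: "\<And>k. k \<in> K \<Longrightarrow> F k \<in> sets borel" and G: "\<And>j. j \<in> J \<Longrightarrow> G j \<in> sets borel"
    and card: "\<And>x. card {k \<in> K. x \<in> F k} \<le> c * card {j \<in> J. x \<in> G j}"
  shows "(\<Sum>k\<in>K. \<mu> (S \<inter> F k)) \<le> of_nat c * (\<Sum>j\<in>J. \<mu> (S \<inter> G j))"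
proof -
  define f where "f B = \<mu> (S \<inter> B)" for B
  define \<Lambda> where "\<Lambda> = lambda_system UNIV UNIV f"
  have out: "outer_measure_space UNIV \<mu>"
    using \<mu> by (simp add: metric_outer_measure_def)
  have f: "outer_measure_space UNIV f"
    unfolding outer_measure_space_UNIV_iff
  proof (intro conjI allI impI)
    show "f (\<Union>i. C i) \<le> (\<Sum>i. f (C i))" for C :: "nat \<Rightarrow> 'a set"
      using outer_measure_UN_le[OF out, of "\<lambda>i. S \<inter> C i"] by (simp add: f_def)
    show "f A \<le> f B" if "A \<subseteq> B" for A B
      using out Int_mono[OF order_refl that] by (simp add: f_def outer_measure_space_UNIV_iff)
    show "f {} = 0"
      using out by (simp add: f_def outer_measure_space_UNIV_iff)
  qed
  interpret sigma_algebra UNIV "UNIV :: 'a set set"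
    using sigma_algebra_Pow[of "UNIV :: 'a set"] by simp
  have ms: "measure_space UNIV \<Lambda> f"
    unfolding \<Lambda>_def by (rule caratheodory_lemma[OF f])
  then interpret L: sigma_algebra UNIV \<Lambda>
    by (simp add: measure_space_def)
  have "C \<in> \<Lambda>" if "closed C" for C
    unfolding \<Lambda>_def lambda_system_eq
  proof (intro CollectI conjI ballI UNIV_I)
    fix E
    have "f (E \<inter> C) + f (E - C) \<le> f E"
      using closed_caratheodory_measurable[OF \<mu> that, of "S \<inter> E"] by (simp add: f_def Int_assoc Int_Diff)
    moreover have "f E \<le> f (E \<inter> C) + f (E - C)"
      using outer_measure_Un_le[OF f, of "E \<inter> C" "E - C"] by (simp add: Int_Diff_Un)
    ultimately show "f (E \<inter> C) + f (E - C) = f E" by (rule antisym)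
  qed
  then have borel: "sets borel \<subseteq> \<Lambda>"
    unfolding borel_eq_closed by (auto intro!: L.sigma_sets_subset)
  define M where "M = measure_of UNIV \<Lambda> f"
  have sM: "sets M = \<Lambda>"
    by (simp add: M_def L.sigma_sets_eq)
  have eM: "emeasure M B = f B" if "B \<in> \<Lambda>" for B
    unfolding M_def using ms that
    by (intro emeasure_measure_of_sigma) (auto simp: measure_space_def)
  have sets: "\<And>k. k \<in> K \<Longrightarrow> F k \<in> sets M" "\<And>j. j \<in> J \<Longrightarrow> G j \<in> sets M"
    using F G borel sM by auto
  have "(\<Sum>k\<in>K. \<mu> (S \<inter> F k)) = (\<Sum>k\<in>K. \<integral>\<^sup>+x. indicator (F k) x \<partial>M)"
    using sets eM sM by (intro sum.cong) (auto simp: f_def)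
  also have "\<dots> = (\<integral>\<^sup>+x. (\<Sum>k\<in>K. indicator (F k) x) \<partial>M)"
    using sets by (subst nn_integral_sum) auto
  also have "\<dots> \<le> (\<integral>\<^sup>+x. of_nat c * (\<Sum>j\<in>J. indicator (G j) x) \<partial>M)"
  proof (rule nn_integral_mono)
    fix x
    have "of_nat (card {k \<in> K. x \<in> F k}) \<le> (of_nat (c * card {j \<in> J. x \<in> G j}) :: ennreal)"
      using card by (intro of_nat_mono)
    then show "(\<Sum>k\<in>K. indicator (F k) x) \<le> (of_nat c * (\<Sum>j\<in>J. indicator (G j) x) :: ennreal)"
      using fin by (simp add: sum_indicator_eq_card_Collect)
  qed
  also have "\<dots> = of_nat c * (\<Sum>j\<in>J. \<integral>\<^sup>+x. indicator (G j) x \<partial>M)"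
    using sets by (subst nn_integral_cmult) (auto simp: nn_integral_sum intro!: borel_measurable_sum)
  also have "\<dots> = of_nat c * (\<Sum>j\<in>J. \<mu> (S \<inter> G j))"
    using sets eM sM by (intro arg_cong2[where f="(*)"] sum.cong) (auto simp: f_def)
  finally show ?thesis .
qed


section \<open>Hausdorff measure\<close>

definition hausdorff_weight :: "nat \<Rightarrow> 'a::metric_space set \<Rightarrow> ennreal" where
  "hausdorff_weight k C =
     (if C = {} then 0 else ennreal (unit_ball_vol (real k) * (diameter C / 2) ^ k))"

definition hausdorff_covers :: "real \<Rightarrow> 'a::metric_space set \<Rightarrow> (nat \<Rightarrow> 'a set) set" where
  "hausdorff_covers \<delta> S = {C. S \<subseteq> (\<Union>i. C i) \<and> (\<forall>i. bounded (C i) \<and> diameter (C i) \<le> \<delta>)}"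

text \<open>The size-\<open>\<delta>\<close> premeasure, which increases to Hausdorff measure as
  \<open>\<delta>\<close> decreases to 0.\<close>

definition hausdorff_content :: "nat \<Rightarrow> real \<Rightarrow> 'a::metric_space set \<Rightarrow> ennreal" where
  "hausdorff_content k \<delta> S = (INF C\<in>hausdorff_covers \<delta> S. \<Sum>i. hausdorff_weight k (C i))"

lemma hausdorff_outer_eq: "hausdorff_outer k S = (SUP \<delta>\<in>{0<..}. hausdorff_content k \<delta> S)"
  by (simp add: hausdorff_outer_def hausdorff_content_def hausdorff_covers_def hausdorff_weight_def)

lemma hausdorff_content_mono:
  assumes "S \<subseteq> T" "\<epsilon> \<le> \<delta>"
  shows "hausdorff_content k \<delta> S \<le> hausdorff_content k \<epsilon> T"
  unfolding hausdorff_content_def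
proof (rule INF_superset_mono)
  show "hausdorff_covers \<epsilon> T \<subseteq> hausdorff_covers \<delta> S"
    using assms by (auto simp: hausdorff_covers_def intro: order_trans)
qed simp

lemma hausdorff_content_empty:
  assumes "0 < \<delta>"
  shows "hausdorff_content k \<delta> {} = 0"
proof -
  have "(\<lambda>_. {}) \<in> hausdorff_covers \<delta> ({} :: 'a set)"
    using assms by (simp add: hausdorff_covers_def)
  then have "hausdorff_content k \<delta> ({} :: 'a set) \<le> 0"
    unfolding hausdorff_content_def by (rule INF_lower2) (simp add: hausdorff_weight_def)
  then show ?thesis by simp
qed

text \<open>Covers of the \<open>n\<close>-th set that are optimal up to
  \<open>e * (1/2) ^ Suc n\<close> are merged into one sequence by a pairing bijection; the errors
  add up to \<open>e\<close>.\<close>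

lemma hausdorff_content_UN_le:
  "hausdorff_content k \<delta> (\<Union>n. S n) \<le> (\<Sum>n. hausdorff_content k \<delta> (S n))"
proof (rule ennreal_le_epsilon)
  fix e :: real assume e: "0 < e" and fin: "(\<Sum>n. hausdorff_content k \<delta> (S n)) < top"
  have "\<exists>C\<in>hausdorff_covers \<delta> (S n). (\<Sum>i. hausdorff_weight k (C i)) <
      hausdorff_content k \<delta> (S n) + ennreal (e * (1/2) ^ Suc n)" for n
  proof (rule INF_approx_ennreal)
    have "hausdorff_content k \<delta> (S n) < top"
      using fin by (rule ennreal_suminf_lessD)
    then show "hausdorff_content k \<delta> (S n) \<noteq> \<infinity>" by simp
  qed (use e in \<open>simp_all add: hausdorff_content_def\<close>)
  then obtain C where C: "\<And>n. C n \<in> hausdorff_covers \<delta> (S n)"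
    and C_le: "\<And>n. (\<Sum>i. hausdorff_weight k (C n i)) \<le>
      hausdorff_content k \<delta> (S n) + ennreal (e * (1/2) ^ Suc n)"
    by (metis less_imp_le)
  define D where "D = case_prod C \<circ> prod_decode"
  have "(\<Union>n. S n) \<subseteq> (\<Union>i. D i)"
  proof
    fix x assume "x \<in> (\<Union>n. S n)"
    then obtain n i where "x \<in> C n i"
      using C by (force simp: hausdorff_covers_def)
    then have "x \<in> D (prod_encode (n, i))" by (simp add: D_def)
    then show "x \<in> (\<Union>i. D i)" by blast
  qed
  then have "D \<in> hausdorff_covers \<delta> (\<Union>n. S n)"
    using C by (simp add: hausdorff_covers_def D_def split_def)
  then have "hausdorff_content k \<delta> (\<Union>n. S n) \<le> (\<Sum>i. hausdorff_weight k (D i))"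
    unfolding hausdorff_content_def by (rule INF_lower)
  also have "\<dots> = (\<Sum>i. (hausdorff_weight k \<circ> case_prod C) (prod_decode i))"
    by (simp add: D_def)
  also have "\<dots> = (\<Sum>n. \<Sum>i. hausdorff_weight k (C n i))"
    by (rule suminf_ennreal_2dimen) simp
  also have "\<dots> \<le> (\<Sum>n. hausdorff_content k \<delta> (S n) + ennreal (e * (1/2) ^ Suc n))"
    by (intro suminf_le C_le) auto
  also have "\<dots> = (\<Sum>n. hausdorff_content k \<delta> (S n)) + (\<Sum>n. ennreal (e * (1/2) ^ Suc n))"
    by (rule suminf_add[symmetric]) auto
  also have "(\<Sum>n. ennreal (e * (1/2) ^ Suc n)) = ennreal e"
    using e sums_mult[OF power_half_series, of e] by (intro suminf_ennreal_eq) auto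
  finally show "hausdorff_content k \<delta> (\<Union>n. S n) \<le> (\<Sum>n. hausdorff_content k \<delta> (S n)) + ennreal e" .
qed

text \<open>A set of diameter less than \<open>d\<close> meets at most one of \<open>S\<close> and \<open>T\<close>.\<close>

lemma hausdorff_content_separated:
  assumes "\<delta> < d" and sep: "\<And>x y. x \<in> S \<Longrightarrow> y \<in> T \<Longrightarrow> d \<le> dist x y"
  shows "hausdorff_content k \<delta> S + hausdorff_content k \<delta> T \<le> hausdorff_content k \<delta> (S \<union> T)"
  unfolding hausdorff_content_def[of k \<delta> "S \<union> T"]
proof (rule INF_greatest)
  fix C assume C: "C \<in> hausdorff_covers \<delta> (S \<union> T)"
  \<comment> \<open>Members of the cover that miss \<open>U\<close> become empty and cost nothing,
    even for \<open>k = 0\<close>.\<close>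
  define restr where "restr U i = (if C i \<inter> U = {} then {} else C i)" for U i
  have content_le: "hausdorff_content k \<delta> U \<le> (\<Sum>i. hausdorff_weight k (restr U i))"
    if "U \<subseteq> S \<union> T" for U
    unfolding hausdorff_content_def
  proof (rule INF_lower)
    \<comment> \<open>The substituted empty sets have diameter 0, so they are admissible only for
      nonnegative \<open>\<delta>\<close>.\<close>
    have "0 \<le> \<delta>"
      using C diameter_ge_0[of "C 0"] by (auto simp: hausdorff_covers_def intro: order_trans)
    moreover have "U \<subseteq> (\<Union>i. restr U i)"
      using C that by (force simp: hausdorff_covers_def restr_def)
    ultimately show "restr U \<in> hausdorff_covers \<delta> U"
      using C by (auto simp: hausdorff_covers_def restr_def)
  qed
  have weight_le: "hausdorff_weight k (restr S i) + hausdorff_weight k (restr T i) \<le> hausdorff_weight k (C i)" for i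
  proof (cases "C i \<inter> S = {} \<or> C i \<inter> T = {}")
    case False
    then obtain x y where "x \<in> C i" "x \<in> S" "y \<in> C i" "y \<in> T" by blast
    moreover have "bounded (C i)" "diameter (C i) \<le> \<delta>"
      using C by (auto simp: hausdorff_covers_def)
    ultimately show ?thesis
      using sep[of x y] diameter_bounded_bound[of "C i" x y] \<open>\<delta> < d\<close> by force
  qed (auto simp: restr_def hausdorff_weight_def)
  have "hausdorff_content k \<delta> S + hausdorff_content k \<delta> T
      \<le> (\<Sum>i. hausdorff_weight k (restr S i)) + (\<Sum>i. hausdorff_weight k (restr T i))"
    by (intro add_mono content_le) auto
  also have "\<dots> = (\<Sum>i. hausdorff_weight k (restr S i) + hausdorff_weight k (restr T i))"
    by (rule suminf_add) auto
  also have "\<dots> \<le> (\<Sum>i. hausdorff_weight k (C i))"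
    by (intro suminf_le weight_le) auto
  finally show "hausdorff_content k \<delta> S + hausdorff_content k \<delta> T \<le> (\<Sum>i. hausdorff_weight k (C i))" .
qed

text \<open>The properties pass from the contents to their supremum. For sets at distance
  \<open>d\<close>, monotonicity in \<open>\<delta>\<close> lets one scale serve both sets, and this
  scale may be shrunk below \<open>d\<close>.\<close>

lemma metric_outer_measure_hausdorff: "metric_outer_measure (hausdorff_outer k)"
  unfolding metric_outer_measure_def outer_measure_space_UNIV_iff
proof (intro conjI allI impI)
  show "hausdorff_outer k ({} :: 'a set) = 0"
    by (simp add: hausdorff_outer_eq hausdorff_content_empty)
  show "hausdorff_outer k S \<le> hausdorff_outer k T" if "S \<subseteq> T" for S T :: "'a set"
    unfolding hausdorff_outer_eq using that by (intro SUP_mono') (auto intro: hausdorff_content_mono)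
  show "hausdorff_outer k (\<Union>i. S i) \<le> (\<Sum>i. hausdorff_outer k (S i))" for S :: "nat \<Rightarrow> 'a set"
    unfolding hausdorff_outer_eq[of k "\<Union>i. S i"]
  proof (rule SUP_least)
    fix \<delta> :: real assume "\<delta> \<in> {0<..}"
    then show "hausdorff_content k \<delta> (\<Union>i. S i) \<le> (\<Sum>i. hausdorff_outer k (S i))"
      unfolding hausdorff_outer_eq
      by (intro order_trans[OF hausdorff_content_UN_le] suminf_le SUP_upper) auto
  qed
next
  fix S T :: "'a set" and d :: real
  assume d: "0 < d" "\<forall>x\<in>S. \<forall>y\<in>T. d \<le> dist x y"
  have "hausdorff_outer k S + hausdorff_outer k T =
      (SUP \<delta>\<in>{0<..}. hausdorff_content k \<delta> S + hausdorff_content k \<delta> T)"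
    unfolding hausdorff_outer_eq
  proof (rule SUP_add_directed_ennreal[symmetric])
    fix \<delta> \<epsilon> :: real assume "\<delta> \<in> {0<..}" "\<epsilon> \<in> {0<..}"
    then show "\<exists>\<eta>\<in>{0<..}. hausdorff_content k \<delta> S + hausdorff_content k \<epsilon> T
        \<le> hausdorff_content k \<eta> S + hausdorff_content k \<eta> T"
      by (intro bexI[of _ "min \<delta> \<epsilon>"] add_mono hausdorff_content_mono) auto
  qed
  also have "\<dots> \<le> hausdorff_outer k (S \<union> T)"
  proof (rule SUP_least)
    fix \<delta> :: real assume "\<delta> \<in> {0<..}"
    then have \<eta>: "0 < min \<delta> (d / 2)" "min \<delta> (d / 2) < d" using d by auto
    have "hausdorff_content k \<delta> S + hausdorff_content k \<delta> T
        \<le> hausdorff_content k (min \<delta> (d / 2)) S + hausdorff_content k (min \<delta> (d / 2)) T"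
      by (intro add_mono hausdorff_content_mono) auto
    also have "\<dots> \<le> hausdorff_content k (min \<delta> (d / 2)) (S \<union> T)"
      using d by (intro hausdorff_content_separated[OF \<eta>(2)]) auto
    also have "\<dots> \<le> hausdorff_outer k (S \<union> T)"
      unfolding hausdorff_outer_eq using \<eta> by (intro SUP_upper) auto
    finally show "hausdorff_content k \<delta> S + hausdorff_content k \<delta> T \<le> hausdorff_outer k (S \<union> T)" .
  qed
  finally show "hausdorff_outer k S + hausdorff_outer k T \<le> hausdorff_outer k (S \<union> T)" .
qed


section \<open>Carving a regular closed set\<close>

text \<open>The interior relative to \<open>S\<close>, written through the ambient closure so that
  no closure has to be taken in a subspace.\<close>

definition rel_int :: "'a::topological_space set \<Rightarrow> 'a set \<Rightarrow> 'a set" where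
  "rel_int S r = S - closure (S - r)"

lemma rel_int_subset: "rel_int S r \<subseteq> r"
  using closure_subset[of "S - r"] by (auto simp: rel_int_def)

lemma rel_int_maximal:
  assumes "openin (top_of_set S) U" "U \<subseteq> r"
  shows "U \<subseteq> rel_int S r"
proof -
  obtain V where "open V" "U = S \<inter> V"
    using assms(1) by (auto simp: openin_open)
  moreover have "V \<inter> closure (S - r) = {}"
    using assms calculation by (auto simp: open_Int_closure_eq_empty)
  ultimately show ?thesis by (auto simp: rel_int_def)
qed

lemma openin_rel_int: "openin (top_of_set S) (rel_int S r)"
  unfolding rel_int_def by (auto simp: openin_open intro!: exI[of _ "- closure (S - r)"])

lemma top_of_set_closure_of:
  "closed S \<Longrightarrow> r \<subseteq> S \<Longrightarrow> top_of_set S closure_of r = closure r"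
  by (simp add: closure_of_subtopology closure_minimal inf.absorb2)

lemma top_of_set_interior_of:
  "closed S \<Longrightarrow> top_of_set S interior_of r = rel_int S r"
  by (simp add: interior_of_closure_of rel_int_def top_of_set_closure_of)

lemma top_of_set_frontier_of:
  "closed S \<Longrightarrow> closed r \<Longrightarrow> r \<subseteq> S \<Longrightarrow> top_of_set S frontier_of r = r \<inter> closure (S - r)"
  by (simp add: frontier_of_closures top_of_set_closure_of)

text \<open>The regions \<open>r j\<close> are cut out of \<open>R\<close> in the order of their indices; the piece \<open>Q i\<close> is what
  remains.\<close>

locale carving =
  fixes S R :: "'a::topological_space set" and J :: "nat set" and i :: nat and r :: "nat \<Rightarrow> 'a set"
  assumes closed_S: "closed S" and R_sub: "R \<subseteq> S" and R_regular: "R = closure (rel_int S R)"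
    and fin: "finite J" and i_notin: "i \<notin> J"
    and r_sub: "\<And>j. j \<in> J \<Longrightarrow> r j \<subseteq> R"
    and r_regular: "\<And>j. j \<in> J \<Longrightarrow> r j = closure (rel_int S (r j))"
begin

definition whole :: "nat \<Rightarrow> 'a set" where
  "whole k = (if k = i then R else r k)"

text \<open>This puts \<open>i\<close> last in the order of cutting, whatever its numerical
  value.\<close>

definition before :: "nat \<Rightarrow> nat set" where
  "before k = (if k = i then J else {l \<in> J. l < k})"

text \<open>Subtracting from the relative interior and closing afterwards yields a regular closed
  set.\<close>

definition Q :: "nat \<Rightarrow> 'a set" where
  "Q k = closure (rel_int S (whole k) - (\<Union>l\<in>before k. r l))"

lemma closed_r: "j \<in> J \<Longrightarrow> closed (r j)"
  using r_regular by (metis closed_closure)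

lemma closed_R: "closed R"
  using R_regular by (metis closed_closure)

lemma before_subset: "before k \<subseteq> J"
  by (auto simp: before_def)

lemma closed_before: "closed (\<Union>l\<in>before k. r l)"
  using fin before_subset by (intro closed_UN) (auto intro: closed_r finite_subset)

lemma before_total:
  "k \<in> insert i J \<Longrightarrow> l \<in> insert i J \<Longrightarrow> k \<noteq> l \<Longrightarrow> k \<in> before l \<or> l \<in> before k"
  using i_notin by (auto simp: before_def)

lemma whole_regular: "k \<in> insert i J \<Longrightarrow> closure (rel_int S (whole k)) = whole k"
  using R_regular[symmetric] r_regular[symmetric] by (auto simp: whole_def)

lemma Q_subset_whole: "k \<in> insert i J \<Longrightarrow> Q k \<subseteq> whole k"
  unfolding Q_def using whole_regular by (metis Diff_subset closure_mono)

lemma whole_subset: "k \<in> insert i J \<Longrightarrow> whole k \<subseteq> R"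
  using r_sub by (auto simp: whole_def)

lemma Q_subset: "k \<in> insert i J \<Longrightarrow> Q k \<subseteq> R"
  using Q_subset_whole whole_subset by blast

lemma closed_Q: "closed (Q k)"
  by (simp add: Q_def)

text \<open>The complement of the earlier regions is an open neighbourhood of \<open>p\<close>, and
  \<open>p\<close> is a limit of relative interior points of \<open>whole k\<close>; those close to
  \<open>p\<close> survive the cutting.\<close>

lemma mem_Q:
  assumes "k \<in> insert i J" "p \<in> whole k" "\<And>l. l \<in> before k \<Longrightarrow> p \<notin> r l"
  shows "p \<in> Q k"
proof -
  have "p \<in> (- (\<Union>l\<in>before k. r l)) \<inter> closure (rel_int S (whole k))"
    using assms whole_regular by auto
  also have "\<dots> \<subseteq> closure ((- (\<Union>l\<in>before k. r l)) \<inter> rel_int S (whole k))"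
    using closed_before by (intro open_Int_closure_subset open_Compl)
  finally show ?thesis
    by (simp add: Q_def Diff_eq Int_commute)
qed

text \<open>A point goes to the first region that contains it, or to the remainder if there is
  none.\<close>

lemma ex_mem_Q:
  assumes "p \<in> R"
  shows "\<exists>k\<in>insert i J. p \<in> Q k"
proof (cases "\<exists>l\<in>J. p \<in> r l")
  case True
  define k where "k = (LEAST l. l \<in> J \<and> p \<in> r l)"
  have k: "k \<in> J \<and> p \<in> r k"
    unfolding k_def using True by (intro LeastI_ex[of "\<lambda>l. l \<in> J \<and> p \<in> r l"]) blast
  have "p \<notin> r l" if "l \<in> J" "l < k" for l
    using that not_less_Least unfolding k_def by blast
  then have "p \<in> Q k"
    using k i_notin by (intro mem_Q) (auto simp: whole_def before_def split: if_splits)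
  then show ?thesis using k by blast
next
  case False
  then have "p \<in> Q i"
    using assms before_subset by (intro mem_Q) (auto simp: whole_def)
  then show ?thesis by blast
qed

text \<open>The set whose closure is \<open>Q k\<close> is relatively open, so it lies in the
  relative interior of \<open>Q k\<close>.\<close>

lemma Q_regular:
  assumes "k \<in> insert i J"
  shows "closure (rel_int S (Q k)) = Q k"
proof
  have "rel_int S (Q k) \<subseteq> Q k"
    using rel_int_subset .
  then show "closure (rel_int S (Q k)) \<subseteq> Q k"
    using closed_Q by (rule closure_minimal)
  let ?U = "rel_int S (whole k) - (\<Union>l\<in>before k. r l)"
  have "openin (top_of_set S) (rel_int S (whole k) \<inter> - (\<Union>l\<in>before k. r l))"
    using openin_rel_int closed_before by (intro openin_Int_open open_Compl)
  then have "?U \<subseteq> rel_int S (Q k)"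
    using closure_subset[of ?U] by (intro rel_int_maximal) (auto simp: Q_def Diff_eq)
  then show "Q k \<subseteq> closure (rel_int S (Q k))"
    unfolding Q_def[of k] by (rule closure_mono)
qed

text \<open>The earlier piece lies in \<open>r k\<close>, while the later one is the closure of a
  set that avoids \<open>r k\<close>.\<close>

lemma Q_Int_Q:
  assumes "k \<in> before l" "l \<in> insert i J" "p \<in> Q k" "p \<in> Q l"
  shows "p \<in> r k \<inter> closure (R - r k)"
proof -
  have k: "k \<in> J" using assms(1) before_subset by blast
  then have "p \<in> r k"
    using Q_subset_whole[of k] assms(3) i_notin by (auto simp: whole_def split: if_splits)
  moreover have "rel_int S (whole l) - (\<Union>l\<in>before l. r l) \<subseteq> R - r k"
    using rel_int_subset[of S "whole l"] whole_subset[OF assms(2)] assms(1) by blast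
  then have "Q l \<subseteq> closure (R - r k)"
    unfolding Q_def by (rule closure_mono)
  ultimately show ?thesis using assms(4) by blast
qed

text \<open>Away from the boundaries of all regions, a point of \<open>Q k\<close> lies outside
  every earlier region and in the interior of \<open>whole k\<close> relative to \<open>R\<close>.
  By \<open>mem_Q\<close>, all nearby points of \<open>R\<close> are then in \<open>Q k\<close>
  too.\<close>

lemma Q_frontier:
  assumes k: "k \<in> insert i J" and p: "p \<in> Q k" "p \<in> closure (R - Q k)"
  shows "\<exists>l\<in>J. p \<in> r l \<inter> closure (R - r l)"
proof (rule ccontr)
  assume contr: "\<not> (\<exists>l\<in>J. p \<in> r l \<inter> closure (R - r l))"
  have pR: "p \<in> R" using k p Q_subset by blast
  have not_before: "p \<notin> r l" if "l \<in> before k" for l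
  proof
    assume "p \<in> r l"
    then have "p \<notin> closure (R - r l)" using contr that before_subset by blast
    moreover have "rel_int S (whole k) - (\<Union>l\<in>before k. r l) \<subseteq> R - r l"
      using rel_int_subset[of S "whole k"] whole_subset[OF k] that by blast
    then have "Q k \<subseteq> closure (R - r l)"
      unfolding Q_def by (rule closure_mono)
    ultimately show False using p by blast
  qed
  have "p \<notin> closure (R - whole k)"
    using contr k p Q_subset_whole[of k] by (auto simp: whole_def)
  then have "p \<in> - closure (R - whole k) \<inter> - (\<Union>l\<in>before k. r l) \<inter> closure (R - Q k)"
    using not_before p by blast
  moreover have "open (- closure (R - whole k) \<inter> - (\<Union>l\<in>before k. r l))"
    using closed_before by (intro open_Int open_Compl closed_closure)
  ultimately have "(- closure (R - whole k) \<inter> - (\<Union>l\<in>before k. r l)) \<inter> (R - Q k) \<noteq> {}"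
    using open_Int_closure_eq_empty by blast
  then obtain q where "q \<in> R - Q k" "q \<notin> closure (R - whole k)" "\<And>l. l \<in> before k \<Longrightarrow> q \<notin> r l"
    by blast
  then show False
    using mem_Q[OF k, of q] closure_subset[of "R - whole k"] by blast
qed

text \<open>If \<open>p\<close> lies in the boundaries of two pieces, it lies in the boundary of the region \<open>r k\<close> from
  which the first of them was cut. So at most one piece with \<open>p\<close> in its boundary is not accounted for
  by a region, and there is at least one region with \<open>p\<close> in its boundary.\<close>

lemma card_frontiers_le:
  "card {k \<in> insert i J. p \<in> Q k \<inter> closure (S - Q k) \<inter> rel_int S R}
    \<le> 2 * card {j \<in> J. p \<in> r j \<inter> closure (S - r j) \<inter> rel_int S R}" (is "card ?K \<le> 2 * card ?M")
proof (cases "?K = {}")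
  case False
  then have int: "p \<in> rel_int S R" by blast
  have fr_r: "l \<in> ?M" if "l \<in> J" "p \<in> r l \<inter> closure (R - r l)" for l
    using that int R_sub closure_mono[of "R - r l" "S - r l"] by blast
  obtain k where k: "k \<in> ?K" using False by blast
  \<comment> \<open>Since \<open>p\<close> is not a limit of \<open>S - R\<close>, boundaries at
    \<open>p\<close> relative to \<open>S\<close> and to \<open>R\<close> agree.\<close>
  have "closure (S - Q k) \<subseteq> closure ((S - R) \<union> (R - Q k))"
    by (intro closure_mono) auto
  then have "p \<in> closure (R - Q k)"
    using k by (auto simp: rel_int_def)
  then have "?M \<noteq> {}"
    using Q_frontier[of k p] k fr_r by blast
  then have M: "1 \<le> card ?M"
    using fin by (simp add: Suc_le_eq card_gt_0_iff)
  have same: "k = l" if "k \<in> ?K - ?M" "l \<in> ?K - ?M" for k l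
  proof (rule ccontr)
    assume "k \<noteq> l"
    have "False" if "a \<in> ?K - ?M" "b \<in> ?K - ?M" "a \<in> before b" for a b
      using Q_Int_Q[of a b p] fr_r[of a] that before_subset by blast
    then show False
      using before_total[of k l] that \<open>k \<noteq> l\<close> by blast
  qed
  have "card (?K - ?M) \<le> 1"
    using same fin by (auto simp: card_le_Suc0_iff_eq)
  then have "card ?K \<le> card ?M + 1"
    using card_Diff_subset_Int[of ?K ?M] diff_card_le_card_Diff[of ?M ?K] fin by auto
  then show ?thesis using M by linarith
next
  case True
  show ?thesis unfolding True by simp
qed

end


section \<open>Areas of the pieces\<close>

lemma area_outer_measure:
  fixes X :: "('a::metric_space, 'n::finite) rmfd"
  shows "metric_outer_measure (area X)"
proof -
  have "area X = hausdorff_outer (CARD('n) - 1)"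
    by (simp add: fun_eq_iff area_def)
  then show ?thesis by (simp only: metric_outer_measure_hausdorff)
qed

lemma area_mono: "S \<subseteq> T \<Longrightarrow> area X S \<le> area X T"
  using area_outer_measure[of X] by (simp add: metric_outer_measure_def outer_measure_space_UNIV_iff)

lemma area_null_mono: "area_null X T \<Longrightarrow> S \<subseteq> T \<Longrightarrow> area_null X S"
  using area_mono[of S T X] by simp

lemma area_Un_le: "area X (S \<union> T) \<le> area X S + area X T"
  using area_outer_measure[of X] by (simp add: metric_outer_measure_def outer_measure_Un_le)

lemma area_null_empty: "area_null X {}"
  using area_outer_measure[of X] by (simp add: metric_outer_measure_def outer_measure_space_UNIV_iff)

lemma area_null_Un: "area_null X S \<Longrightarrow> area_null X T \<Longrightarrow> area_null X (S \<union> T)"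
  using area_Un_le[of X S T] by simp

lemma area_null_UN: "finite I \<Longrightarrow> (\<And>k. k \<in> I \<Longrightarrow> area_null X (S k)) \<Longrightarrow> area_null X (\<Union>k\<in>I. S k)"
  by (induction I rule: finite_induct) (auto simp: area_null_empty intro!: area_null_Un)

text \<open>The bound for one fixed choice of competitors; infima are taken afterwards. Closedness
  of the manifold turns the subspace operations into ambient ones, as \<open>carving\<close>
  requires.\<close>

lemma E_w_le_regions:
  fixes X :: "('a::metric_space, 'n::finite) rmfd"
  assumes closed: "closed (points X)" and i: "i < n"
    and A: "\<And>k. k < n \<Longrightarrow> A k \<subseteq> mbdry X"
    and R: "region_containing X (points X) (\<Union>k<n. A k) R"
    and r: "\<And>j. j \<in> {..<n} - {i} \<Longrightarrow> region_containing X R (A j) (r j)"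
    and rA: "\<And>j k. j \<in> {..<n} - {i} \<Longrightarrow> k < n \<Longrightarrow> k \<noteq> j \<Longrightarrow> area_null X (r j \<inter> A k)"
  shows "E_w X n A R \<le> 2 * (\<Sum>j\<in>{..<n} - {i}. area X (bdry X (r j) - (A j \<union> outer_surface X n A R)))"
proof -
  define S where "S = points X"
  define J where "J = {..<n} - {i}"
  define O' where "O' = outer_surface X n A R"
  have iJ: "insert i J = {..<n}" using i by (auto simp: J_def)
  have closed_S: "closed S" using closed by (simp add: S_def)
  have reg: "r = closure (rel_int S r)" if "region_in X D r" for r D
    using that rel_int_def[of S r] unfolding region_in_def S_def[symmetric]
    by (metis Diff_subset closed_S top_of_set_closure_of top_of_set_interior_of)
  have R_region: "region_in X S R" and r_region: "\<And>j. j \<in> J \<Longrightarrow> region_in X R (r j)"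
    using R r by (auto simp: region_containing_def S_def J_def)
  interpret carving S R J i r
  proof unfold_locales
    show "R = closure (rel_int S R)" using reg[OF R_region] .
    show "r j = closure (rel_int S (r j))" if "j \<in> J" for j using reg[OF r_region[OF that]] .
  qed (use closed_S R_region r_region in \<open>auto simp: J_def region_in_def\<close>)
  have fr_S: "top_of_set S frontier_of q = q \<inter> closure (S - q)" if "closed q" "q \<subseteq> R" for q
    using top_of_set_frontier_of[OF closed_S] that R_sub by blast
  have fr_R: "top_of_set R frontier_of q = q \<inter> closure (R - q)" if "closed q" "q \<subseteq> R" for q
    using top_of_set_frontier_of[OF closed_R] that by blast
  have bdry_sub: "bdry X q \<subseteq> q" if "closed q" "q \<subseteq> R" for q
    using fr_S[OF that] by (auto simp: bdry_def S_def)
  \<comment> \<open>The points of \<open>bdry X R\<close> at which some \<open>r j\<close> has no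
    boundary value, negligible by the last clause of \<open>region_in\<close>. All overlaps of
    different pieces on \<open>bdry X R\<close> fall into this set.\<close>
  define N where "N = (\<Union>j\<in>J. (r j \<inter> closure (R - r j)) \<inter> bdry X R)"
  have N_null: "area_null X N"
    unfolding N_def
  proof (rule area_null_UN[OF fin])
    fix j assume "j \<in> J"
    then show "area_null X ((r j \<inter> closure (R - r j)) \<inter> bdry X R)"
      using r_region[of j] fr_R[OF closed_r r_sub] by (simp add: region_in_def)
  qed
  have QQ: "p \<in> N" if kl_p: "k < n" "l < n" "k \<noteq> l" "p \<in> Q k" "p \<in> Q l" "p \<in> bdry X R" for k l p
  proof -
    have kl: "k \<in> insert i J" "l \<in> insert i J"
      unfolding iJ using that by simp_all
    consider "k \<in> before l" | "l \<in> before k"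
      using before_total[OF kl kl_p(3)] by blast
    then have "\<exists>j\<in>J. p \<in> r j \<inter> closure (R - r j)"
    proof cases
      case 1
      then show ?thesis
        using Q_Int_Q[OF 1 kl(2) kl_p(4,5)] before_subset by blast
    next
      case 2
      then show ?thesis
        using Q_Int_Q[OF 2 kl(1) kl_p(5,4)] before_subset by blast
    qed
    then show ?thesis
      using that by (auto simp: N_def)
  qed
  have Q_region: "region_in X R (Q k)" if "k < n" for k
    unfolding region_in_def S_def[symmetric]
  proof (intro conjI)
    have k: "k \<in> insert i J" using that iJ by blast
    show "Q k \<subseteq> R" using Q_subset[OF k] .
    have "rel_int S (Q k) \<subseteq> S" by (auto simp: rel_int_def)
    then show "Q k = top_of_set S closure_of (top_of_set S interior_of Q k)"
      using Q_regular[OF k] closed_S by (simp add: top_of_set_interior_of top_of_set_closure_of)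
    have "Q k \<inter> closure (R - Q k) \<inter> bdry X R \<subseteq> N"
      using Q_frontier[OF k] by (auto simp: N_def)
    then show "area_null X (top_of_set R frontier_of Q k \<inter> bdry X R)"
      using fr_R[OF closed_Q Q_subset[OF k]] area_null_mono[OF N_null] by simp
  qed
  have AQ_null: "area_null X (A k - Q k)" if k: "k < n" for k
  proof -
    \<comment> \<open>A point of \<open>A k\<close> can be missing from \<open>Q k\<close> only if
      \<open>whole k\<close> misses it or an earlier region takes it; the latter regions meet
      \<open>A k\<close> in null sets.\<close>
    have "area_null X ((A k - whole k) \<union> (\<Union>j\<in>before k. r j \<inter> A k))"
    proof (intro area_null_Un area_null_UN)
      show "area_null X (A k - whole k)"
      proof (cases "k = i")
        case True
        have "area_null X ((\<Union>k<n. A k) - R)"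
          using R by (simp add: region_containing_def)
        then show ?thesis
          by (rule area_null_mono) (use True i in \<open>auto simp: whole_def\<close>)
      qed (use r[of k] k in \<open>auto simp: whole_def region_containing_def\<close>)
      show "finite (before k)"
        using fin before_subset by (rule finite_subset[rotated])
      show "area_null X (r j \<inter> A k)" if "j \<in> before k" for j
      proof (rule rA[OF _ k])
        show "j \<in> {..<n} - {i}" using that before_subset by (auto simp: J_def)
        show "k \<noteq> j" using that i_notin by (auto simp: before_def split: if_splits)
      qed
    qed
    moreover have "A k - Q k \<subseteq> (A k - whole k) \<union> (\<Union>j\<in>before k. r j \<inter> A k)"
      using mem_Q[of k] k iJ by blast
    ultimately show ?thesis by (rule area_null_mono)
  qed
  \<comment> \<open>The boundary of \<open>q\<close> at interior points of \<open>R\<close>, in the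
    form counted by \<open>card_frontiers_le\<close>.\<close>
  define F where "F q = q \<inter> closure (S - q) \<inter> rel_int S R" for q
  define P where "P k = O' \<inter> Q k" for k
  have O'_sub: "O' \<subseteq> bdry X R" by (auto simp: O'_def outer_surface_def)
  have "surface_partition X n O' P"
    unfolding surface_partition_def
  proof (intro conjI allI impI)
    show "closedin (top_of_set O') (P k)" for k
      using closed_Q by (auto simp: P_def closedin_closed)
    have "O' \<subseteq> R" using O'_sub bdry_sub[OF closed_R] by blast
    then show "(\<Union>k<n. P k) = O'"
      using ex_mem_Q iJ by (fastforce simp: P_def)
    show "area_null X (P k \<inter> P l)" if "k < n" "l < n" "k \<noteq> l" for k l
      using QQ[OF that] O'_sub by (intro area_null_mono[OF N_null]) (auto simp: P_def)
  qed
  then have "E_w X n A R \<le> (\<Sum>k<n. min_area X R (A k \<union> P k))"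
    unfolding E_w_def O'_def[symmetric] by (intro INF_lower) simp
  also have "\<dots> \<le> (\<Sum>k<n. area X (- mbdry X \<inter> F (Q k)))"
  proof (rule sum_mono)
    fix k assume "k \<in> {..<n}"
    then have k: "k < n" "k \<in> insert i J" using iJ by auto
    have "region_containing X R (A k \<union> P k) (Q k)"
      using Q_region[OF k(1)]
      by (auto simp: region_containing_def P_def intro: area_null_mono[OF AQ_null[OF k(1)]])
    then have "min_area X R (A k \<union> P k) \<le> area X (bdry X (Q k) - (A k \<union> P k))"
      unfolding min_area_def by (intro INF_lower) simp
    also have "\<dots> \<le> area X ((N \<union> (\<Union>l<n. A l - Q l)) \<union> (- mbdry X \<inter> F (Q k)))"
    proof (rule area_mono, rule subsetI)
      fix p assume p: "p \<in> bdry X (Q k) - (A k \<union> P k)"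
      have pQ: "p \<in> Q k" using bdry_sub[OF closed_Q Q_subset[OF k(2)]] p by blast
      have pR: "p \<in> R" using pQ Q_subset[OF k(2)] by blast
      show "p \<in> (N \<union> (\<Union>l<n. A l - Q l)) \<union> (- mbdry X \<inter> F (Q k))"
      proof (cases "p \<in> bdry X R")
        case True
        \<comment> \<open>A point of \<open>Q k\<close> on \<open>bdry X R\<close> outside
          \<open>A k\<close> and \<open>P k\<close> is not on the outer surface, so it lies in
          another \<open>A l\<close>. Either it is also in \<open>Q l\<close>, hence in
          \<open>N\<close>, or it is in the null set \<open>A l - Q l\<close>.\<close>
        then obtain l where "l < n" "p \<in> A l" "l \<noteq> k"
          using p pQ by (auto simp: P_def O'_def outer_surface_def)
        then show ?thesis using QQ[of k l p] k(1) pQ True by blast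
      next
        case False
        then have "p \<notin> mbdry X" "p \<in> rel_int S R"
          using pR R_sub fr_S[OF closed_R] by (auto simp: bdry_def S_def rel_int_def)
        moreover have "p \<in> closure (S - Q k)"
          using p calculation fr_S[OF closed_Q Q_subset[OF k(2)]] by (auto simp: bdry_def S_def)
        ultimately show ?thesis using pQ by (simp add: F_def)
      qed
    qed
    also have "\<dots> \<le> area X (N \<union> (\<Union>l<n. A l - Q l)) + area X (- mbdry X \<inter> F (Q k))"
      by (rule area_Un_le)
    also have "area X (N \<union> (\<Union>l<n. A l - Q l)) = 0"
      using AQ_null by (intro area_null_Un N_null area_null_UN) auto
    finally show "min_area X R (A k \<union> P k) \<le> area X (- mbdry X \<inter> F (Q k))" by simp
  qed
  also have "\<dots> \<le> of_nat 2 * (\<Sum>j\<in>J. area X (- mbdry X \<inter> F (r j)))"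
  proof (rule sum_outer_measure_le_of_card_le[OF area_outer_measure])
    have "F q \<in> sets borel" if "closed q" for q
      using that closed_S by (auto simp: F_def rel_int_def intro!: sets.Int sets.Diff borel_closed)
    then show "F (Q k) \<in> sets borel" "j \<in> J \<Longrightarrow> F (r j) \<in> sets borel" for k j
      using closed_Q closed_r by auto
    show "card {k \<in> {..<n}. p \<in> F (Q k)} \<le> 2 * card {j \<in> J. p \<in> F (r j)}" for p
      using card_frontiers_le[of p] by (simp only: F_def iJ)
  qed (use fin in auto)
  also have "\<dots> \<le> of_nat 2 * (\<Sum>j\<in>J. area X (bdry X (r j) - (A j \<union> O')))"
  proof (intro mult_left_mono sum_mono area_mono subsetI)
    \<comment> \<open>Nothing of the interior boundary is discarded: \<open>A j\<close> lies in
      \<open>mbdry X\<close> and the outer surface in \<open>bdry X R\<close>, and \<open>p\<close>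
      avoids both.\<close>
    fix j p assume j: "j \<in> J" and p: "p \<in> - mbdry X \<inter> F (r j)"
    have "p \<in> bdry X (r j)"
      using p fr_S[OF closed_r[OF j] r_sub[OF j]] by (auto simp: bdry_def F_def S_def)
    moreover have "p \<notin> A j" using A[of j] j p by (auto simp: J_def)
    moreover have "p \<notin> bdry X R"
      using p fr_S[OF closed_R] by (auto simp: bdry_def F_def S_def rel_int_def)
    ultimately show "p \<in> bdry X (r j) - (A j \<union> O')" using O'_sub by blast
  qed auto
  finally show ?thesis by (simp add: O'_def J_def)
qed

text \<open>Near-optimal competitors are chosen for all \<open>j\<close> at once, and their total
  error is made arbitrarily small.\<close>

lemma le_mult_sum_INF_ennreal:
  fixes f :: "'i \<Rightarrow> 'b \<Rightarrow> ennreal"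
  assumes J: "finite J" and c: "0 < c"
    and le: "\<And>r. (\<And>j. j \<in> J \<Longrightarrow> r j \<in> D j) \<Longrightarrow> x \<le> of_nat c * (\<Sum>j\<in>J. f j (r j))"
  shows "x \<le> of_nat c * (\<Sum>j\<in>J. INF q\<in>D j. f j q)"
proof (rule ennreal_le_epsilon)
  fix e :: real
  assume e: "0 < e" and fin: "of_nat c * (\<Sum>j\<in>J. INF q\<in>D j. f j q) < top"
  \<comment> \<open>The total error is \<open>c * card J * d\<close>, at most \<open>e\<close>; the
    added 1 keeps the denominator positive for empty \<open>J\<close>.\<close>
  define d where "d = e / (real c * (real (card J) + 1))"
  have d: "0 < d" using e c by (simp add: d_def)
  \<comment> \<open>As \<open>c\<close> is positive, a finite right-hand side forces every infimum
    to be finite, so each can be approximated.\<close>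
  have "(\<Sum>j\<in>J. INF q\<in>D j. f j q) \<noteq> top"
    using fin c by (auto simp: ennreal_mult_top)
  then have "(INF q\<in>D j. f j q) \<noteq> \<infinity>" if "j \<in> J" for j
    using J that by simp
  then have "\<exists>q\<in>D j. f j q < (INF q\<in>D j. f j q) + ennreal d" if "j \<in> J" for j
    using INF_approx_ennreal[OF d refl] that by blast
  then obtain r where r: "\<And>j. j \<in> J \<Longrightarrow> r j \<in> D j"
      "\<And>j. j \<in> J \<Longrightarrow> f j (r j) \<le> (INF q\<in>D j. f j q) + ennreal d"
    by (metis less_imp_le)
  have "x \<le> of_nat c * (\<Sum>j\<in>J. f j (r j))"
    using r(1) by (rule le)
  also have "\<dots> \<le> of_nat c * (\<Sum>j\<in>J. (INF q\<in>D j. f j q) + ennreal d)"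
    using r(2) by (intro mult_left_mono sum_mono) auto
  also have "\<dots> = of_nat c * (\<Sum>j\<in>J. INF q\<in>D j. f j q) + of_nat c * (of_nat (card J) * ennreal d)"
    by (simp add: sum.distrib distrib_left)
  also have "of_nat c * (of_nat (card J) * ennreal d) = ennreal (real c * (real (card J) * d))"
    using d by (simp add: ennreal_of_nat_eq_real_of_nat ennreal_mult)
  also have "real c * (real (card J) * d) = e * (real (card J) / (real (card J) + 1))"
    using c by (simp add: d_def)
  also have "ennreal \<dots> \<le> ennreal e"
    using e by (intro ennreal_leI mult_left_le) auto
  finally show "x \<le> of_nat c * (\<Sum>j\<in>J. INF q\<in>D j. f j q) + ennreal e" by simp
qed

theorem mainTheorem5:
  fixes X :: "('a::metric_space, 'n::finite) rmfd"
    and n :: nat and A :: "nat \<Rightarrow> 'a set" and R :: "'a set"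
  assumes "riemannian_manifold_with_boundary X" and "compact (points X)"
    and "n \<ge> 1"
    and "\<And>i. i < n \<Longrightarrow> boundary_region X (A i)"
    and "disjoint_family_on A {..<n}"
    and "unique_minimal_region X (\<Union>i<n. A i) R"
    and "E_w X n A R = relaxed_value X n A R"
  shows "E_w X n A R \<le> 2 * Min ((\<lambda>i. \<Sum>j\<in>{..<n} - {i}. area_bp X n A R j) ` {..<n})"
proof -
  \<comment> \<open>The minimum is attained at some \<open>i\<close>, which becomes the index that
    receives the remainder.\<close>
  have "Min ((\<lambda>i. \<Sum>j\<in>{..<n} - {i}. area_bp X n A R j) ` {..<n})
      \<in> (\<lambda>i. \<Sum>j\<in>{..<n} - {i}. area_bp X n A R j) ` {..<n}"
    using assms(3) by (intro Min_in) (auto simp: lessThan_empty_iff)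
  then obtain i where i: "i < n"
    and Min: "Min ((\<lambda>i. \<Sum>j\<in>{..<n} - {i}. area_bp X n A R j) ` {..<n})
      = (\<Sum>j\<in>{..<n} - {i}. area_bp X n A R j)"
    by auto
  have "E_w X n A R \<le> of_nat 2 * (\<Sum>j\<in>{..<n} - {i}. area_bp X n A R j)"
    unfolding area_bp_def
  proof (rule le_mult_sum_INF_ennreal)
    fix r assume r: "\<And>j. j \<in> {..<n} - {i} \<Longrightarrow> r j \<in> {r. region_containing X R (A j) r \<and>
      (\<forall>k<n. k \<noteq> j \<longrightarrow> area_null X (r \<inter> A k))}"
    have "E_w X n A R \<le>
        2 * (\<Sum>j\<in>{..<n} - {i}. area X (bdry X (r j) - (A j \<union> outer_surface X n A R)))"
    proof (rule E_w_le_regions[OF compact_imp_closed[OF assms(2)] i])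
      show "A k \<subseteq> mbdry X" if "k < n" for k
        using assms(4)[OF that] by (simp add: boundary_region_def)
      show "region_containing X (points X) (\<Union>k<n. A k) R"
        using assms(6) by (simp add: unique_minimal_region_def)
    qed (use r in blast)+
    then show "E_w X n A R \<le>
        of_nat 2 * (\<Sum>j\<in>{..<n} - {i}. area X (bdry X (r j) - (A j \<union> outer_surface X n A R)))"
      by simp
  qed auto
  then show ?thesis by (simp add: Min)
qed

end
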